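(* Let $T$ be an infinite rooted tree, let $\psi:T\to\mathbb{C}$ be a function and let $0<q<p<\infty$. Then the following are equivalent: (a) The multiplication operator $M_\psi:\mathbb{T}_p\to\mathbb{T}_q$ is bounded. (b) The multiplication operator $M_\psi:\mathbb{T}_{p,0}\to\mathbb{T}_{q,0}$ is bounded. (c) $\psi\in\mathbb{T}_{\frac{pq}{p-q}}$. Moreover, in this case $\|M_\psi\|=\|\psi\|_{\frac{pq}{p-q}}$.
   Context: Let $T$ be an infinite rooted tree with root $o$; $T$ also denotes its vertex set. For a vertex $v$, $|v|$ is the number of edges in the unique path from $o$ to $v$. For $n\in\mathbb{N}_0=\{0,1,2,\dots\}$, $D_n=\{v\in T:|v|=n\}$, and $c_n$ is the number of elements of $D_n$, assumed finite for each $n$ (so $1\le c_n<\infty$). For $f:T\to\mathbb{C}$ and $0<p<\infty$ put $M_p(n,f)=\left(\frac1{c_n}\sum_{|v|=n}|f(v)|^p\right)^{1/p}$, and $M_\infty(n,f)=\max_{|v|=n}|f(v)|$. For $0<p\le\infty$ put $\|f\|_p=\sup_{n\in\mathbb{N}_0}M_p(n,f)$, $\mathbb{T}_p=\{f:T\to\mathbb{C}:\|f\|_p<\infty\}$ and $\mathbb{T}_{p,0}=\{f\in\mathbb{T}_p:\lim_{n\to\infty}M_p(n,f)=0\}$ (with the same $\|\cdot\|_p$). For $\psi:T\to\mathbb{C}$, $M_\psi f=\psi f$ (pointwise product). $M_\psi:X\to Y$ is bounded if $\psi f\in Y$ for every $f\in X$ and $\|M_\psi\|:=\sup\{\|\psi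 f\|_Y/\|f\|_X: f\in X, f\neq0\}<\infty$; the norm formula holds for the operator in (a) as well as for the one in (b). *)

theory Defs
  imports
    Complex_Main
    "HOL-Library.Extended_Nonnegative_Real"
    "Graph_Theory.Pair_Digraph"
begin

text \<open>
  An undirected simple graph, possibly infinite, is a \<^locale>\<open>pair_bidirected_digraph\<close>: a loop-free
  symmetric digraph without parallel arcs. The notion of tree in the theory \<open>Digraph_Component\<close>
  is not usable here: it forbids directed cycles, and each undirected edge is a directed 2-cycle.
\<close>

abbreviation tree_path :: "'a pair_pre_digraph \<Rightarrow> 'a \<Rightarrow> ('a \<times> 'a) awalk \<Rightarrow> 'a \<Rightarrow> bool" where
  "tree_path T \<equiv> pre_digraph.apath (with_proj T)"

definition depth :: "'a pair_pre_digraph \<Rightarrow> 'a \<Rightarrow> 'a \<Rightarrow> nat" where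
  "depth T r v = length (THE p. tree_path T r p v)"

definition level :: "'a pair_pre_digraph \<Rightarrow> 'a \<Rightarrow> nat \<Rightarrow> 'a set" where
  "level T r n = {v \<in> pverts T. depth T r v = n}"

locale infinite_rooted_tree = pair_bidirected_digraph T
  for T :: "'a pair_pre_digraph" +
  fixes r :: 'a
  assumes root_in_verts: "r \<in> pverts T"
    and unique_path: "\<And>u v. u \<in> pverts T \<Longrightarrow> v \<in> pverts T \<Longrightarrow> \<exists>!p. tree_path T u p v"
    and infinite_verts: "infinite (pverts T)"
    and finite_level: "\<And>n. finite (level T r n)"

text \<open>
  A complex function on the tree is represented by a total function on the ambient vertex type;
  its values outside \<^term>\<open>pverts T\<close> are irrelevant to everything below. The exponents
  \<open>p\<close> and \<open>q\<close> are meant to be positive reals.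
\<close>

definition level_mean :: "'a pair_pre_digraph \<Rightarrow> 'a \<Rightarrow> real \<Rightarrow> nat \<Rightarrow> ('a \<Rightarrow> complex) \<Rightarrow> real" where
  "level_mean T r p n f =
     ((1 / real (card (level T r n))) * (\<Sum>v\<in>level T r n. cmod (f v) powr p)) powr (1 / p)"

definition hardy_norm :: "'a pair_pre_digraph \<Rightarrow> 'a \<Rightarrow> real \<Rightarrow> ('a \<Rightarrow> complex) \<Rightarrow> ennreal" where
  "hardy_norm T r p f = (SUP n. ennreal (level_mean T r p n f))"

definition hardy_space :: "'a pair_pre_digraph \<Rightarrow> 'a \<Rightarrow> real \<Rightarrow> ('a \<Rightarrow> complex) set" where
  "hardy_space T r p = {f. hardy_norm T r p f < \<infinity>}"

definition little_hardy_space :: "'a pair_pre_digraph \<Rightarrow> 'a \<Rightarrow> real \<Rightarrow> ('a \<Rightarrow> complex) set" where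
  "little_hardy_space T r p =
     {f \<in> hardy_space T r p. (\<lambda>n. level_mean T r p n f) \<longlonglongrightarrow> 0}"

definition mult_op :: "('a \<Rightarrow> complex) \<Rightarrow> ('a \<Rightarrow> complex) \<Rightarrow> 'a \<Rightarrow> complex" where
  "mult_op \<psi> f = (\<lambda>v. \<psi> v * f v)"

text \<open>
  In the next two definitions the operator \<open>F\<close> acts on the domain \<open>X\<close>, normed by
  \<^term>\<open>hardy_norm T r p\<close>; the codomain carries \<^term>\<open>hardy_norm T r q\<close>. The supremum is taken
  in the extended nonnegative reals, so it always makes sense, and may be infinite.
\<close>

definition op_norm ::
  "'a pair_pre_digraph \<Rightarrow> 'a \<Rightarrow> real \<Rightarrow> ('a \<Rightarrow> complex) set \<Rightarrow> real
    \<Rightarrow> (('a \<Rightarrow> complex) \<Rightarrow> 'a \<Rightarrow> complex) \<Rightarrow> ennreal" where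
  "op_norm T r p X q F =
     (SUP f\<in>{f \<in> X. \<exists>v\<in>pverts T. f v \<noteq> 0}. hardy_norm T r q (F f) / hardy_norm T r p f)"

definition bounded_op ::
  "'a pair_pre_digraph \<Rightarrow> 'a \<Rightarrow> real \<Rightarrow> ('a \<Rightarrow> complex) set \<Rightarrow> real \<Rightarrow> ('a \<Rightarrow> complex) set
    \<Rightarrow> (('a \<Rightarrow> complex) \<Rightarrow> 'a \<Rightarrow> complex) \<Rightarrow> bool" where
  "bounded_op T r p X q Y F \<longleftrightarrow> (\<forall>f\<in>X. F f \<in> Y) \<and> op_norm T r p X q F < \<infinity>"

end

theory Submission
  imports Defs "HOL-Analysis.Convex"
begin

text \<open>
  Put \<open>s = p q / (p - q)\<close>, so that \<open>1/q = 1/s + 1/p\<close>. Hoelder's inequality on each level gives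
  \<open>M\<^sub>q(n, \<psi> f) \<le> M\<^sub>s(n, \<psi>) M\<^sub>p(n, f)\<close>, and equality holds when \<open>f\<close> is \<open>\<bar>\<psi>\<bar>\<close> to the power \<open>s/p\<close> on
  level \<open>n\<close>. Cut off to a single level, this extremal function lies in the little space, so
  for every domain between the little and the full space the operator norm is \<open>\<parallel>\<psi>\<parallel>\<^sub>s\<close>, finite or not.
\<close>

text \<open>Dividing by the two sums reduces the claim to the case where both equal 1. Weighted
  AM-GM then bounds each term, and adding these bounds gives
  \<open>\<theta> + (1 - \<theta>) = 1\<close>.\<close>

lemma Holder_sum_powr:
  fixes x y :: "'b \<Rightarrow> real"
  assumes \<theta>: "0 \<le> \<theta>" "\<theta> \<le> 1"
    and nonneg: "\<And>v. v \<in> A \<Longrightarrow> 0 \<le> x v" "\<And>v. v \<in> A \<Longrightarrow> 0 \<le> y v"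
  shows "(\<Sum>v\<in>A. x v powr \<theta> * y v powr (1 - \<theta>))
    \<le> (\<Sum>v\<in>A. x v) powr \<theta> * (\<Sum>v\<in>A. y v) powr (1 - \<theta>)"
proof (cases "finite A \<and> (\<Sum>v\<in>A. x v) > 0 \<and> (\<Sum>v\<in>A. y v) > 0")
  \<comment> \<open>Over an infinite \<open>A\<close> every sum is 0 by default. Otherwise one of
    the two sums vanishes, so every term has a factor with base 0; such a factor is 0 even for
    exponent 0, since \<open>0 powr 0 = 0\<close>.\<close>
  case False
  have "x v powr \<theta> * y v powr (1 - \<theta>) = 0" if "finite A" "v \<in> A" for v
  proof -
    have "(\<Sum>v\<in>A. x v) = 0 \<or> (\<Sum>v\<in>A. y v) = 0"
      using False that(1) sum_nonneg[of A x] sum_nonneg[of A y] nonneg by fastforce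
    then have "x v = 0 \<or> y v = 0"
      using that nonneg sum_nonneg_eq_0_iff[of A x] sum_nonneg_eq_0_iff[of A y] by auto
    then show ?thesis by auto
  qed
  then have "(\<Sum>v\<in>A. x v powr \<theta> * y v powr (1 - \<theta>)) = 0"
    by (meson sum.infinite sum.neutral)
  then show ?thesis by simp
next
  case True
  define X where "X = (\<Sum>v\<in>A. x v)"
  define Y where "Y = (\<Sum>v\<in>A. y v)"
  have pos: "X > 0" "Y > 0" using True by (auto simp: X_def Y_def)
  have "x v powr \<theta> * y v powr (1 - \<theta>)
      \<le> X powr \<theta> * Y powr (1 - \<theta>) * (\<theta> * (x v / X) + (1 - \<theta>) * (y v / Y))" if "v \<in> A" for v
  proof -
    have "(x v / X) powr \<theta> * (y v / Y) powr (1 - \<theta>) \<le> \<theta> * (x v / X) + (1 - \<theta>) * (y v / Y)"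
    \<comment> \<open>\<open>Youngs_inequality_0\<close> asks for positive arguments, so a vanishing
      factor is treated apart; there the left side is 0.\<close>
    proof (cases "x v = 0 \<or> y v = 0")
      case True
      then show ?thesis using \<theta> pos nonneg[OF that] by auto
    next
      case False
      then show ?thesis
        using \<theta> pos nonneg[OF that] by (intro Youngs_inequality_0) auto
    qed
    then show ?thesis
      using pos nonneg[OF that] by (simp add: powr_divide field_simps)
  qed
  then have "(\<Sum>v\<in>A. x v powr \<theta> * y v powr (1 - \<theta>))
      \<le> (\<Sum>v\<in>A. X powr \<theta> * Y powr (1 - \<theta>) * (\<theta> * (x v / X) + (1 - \<theta>) * (y v / Y)))"
    by (rule sum_mono)
  also have "\<dots> = X powr \<theta> * Y powr (1 - \<theta>) * (\<theta> * (X / X) + (1 - \<theta>) * (Y / Y))"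
    by (simp only: X_def Y_def sum.distrib sum_divide_distrib distrib_left sum_distrib_left)
  also have "\<dots> = X powr \<theta> * Y powr (1 - \<theta>)"
    using pos by simp
  finally show ?thesis by (simp add: X_def Y_def)
qed

lemma level_mean_nonneg: "0 \<le> level_mean T r p n f"
  by (simp add: level_mean_def)

lemma level_mean_le_hardy_norm: "ennreal (level_mean T r p n f) \<le> hardy_norm T r p f"
  unfolding hardy_norm_def by (rule SUP_upper) simp

lemma conjugate_exponent:
  fixes p q :: real
  assumes "0 < q" "q < p"
  shows "0 < p * q / (p - q)" "1 / (p * q / (p - q)) = 1 / q - 1 / p"
  using assms by (auto simp: field_simps)

text \<open>Hoelder's inequality for \<open>cmod (\<psi> v) powr s\<close> and
  \<open>cmod (f v) powr p\<close> with weights \<open>\<theta> = q / s\<close> and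
  \<open>1 - \<theta> = q / p\<close>, followed by the power \<open>1 / q\<close>.\<close>

lemma level_mean_mult_op_le:
  assumes "0 < q" "q < p"
  shows "level_mean T r q n (mult_op \<psi> f)
    \<le> level_mean T r (p * q / (p - q)) n \<psi> * level_mean T r p n f"
proof -
  define s where "s = p * q / (p - q)"
  define \<theta> where "\<theta> = q / s"
  define c where "c = 1 / real (card (level T r n))"
  define L where "L = level T r n"
  have s: "s > 0" "1 / s = 1 / q - 1 / p"
    using conjugate_exponent[OF assms] by (auto simp: s_def)
  have \<theta>_eq: "\<theta> = 1 - q / p" "s * \<theta> = q" "p * (1 - \<theta>) = q"
    using assms s by (auto simp: \<theta>_def s_def field_simps)
  have \<theta>: "0 \<le> \<theta>" "\<theta> \<le> 1" using assms \<theta>_eq(1) by auto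
  have exps: "\<theta> * (1 / q) = 1 / s" "(1 - \<theta>) * (1 / q) = 1 / p"
    using assms by (simp add: \<theta>_def, simp add: \<theta>_eq(1))
  \<comment> \<open>The averaging factor splits between the two sums without loss, because the
    weights add up to 1. If \<open>card\<close> is 0, then \<open>c = 1 / 0 = 0\<close> and the
    identity still holds.\<close>
  have c: "c \<ge> 0" "c = c powr \<theta> * c powr (1 - \<theta>)"
    by (auto simp: c_def simp flip: powr_add)
  have "c * (\<Sum>v\<in>L. cmod (mult_op \<psi> f v) powr q)
      = c * (\<Sum>v\<in>L. (cmod (\<psi> v) powr s) powr \<theta> * (cmod (f v) powr p) powr (1 - \<theta>))"
    by (simp add: mult_op_def norm_mult powr_mult powr_powr \<theta>_eq(2,3))
  also have "\<dots> \<le> c * ((\<Sum>v\<in>L. cmod (\<psi> v) powr s) powr \<theta> * (\<Sum>v\<in>L. cmod (f v) powr p) powr (1 - \<theta>))"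
    by (intro mult_left_mono Holder_sum_powr \<theta> c(1)) auto
  also have "\<dots> = (c * (\<Sum>v\<in>L. cmod (\<psi> v) powr s)) powr \<theta> * (c * (\<Sum>v\<in>L. cmod (f v) powr p)) powr (1 - \<theta>)"
    by (subst c(2)) (simp add: powr_mult sum_nonneg c(1))
  finally have "(c * (\<Sum>v\<in>L. cmod (mult_op \<psi> f v) powr q)) powr (1 / q) \<le> \<dots> powr (1 / q)"
    using assms c(1) by (intro powr_mono2) (auto intro!: mult_nonneg_nonneg sum_nonneg)
  also have "\<dots> = (c * (\<Sum>v\<in>L. cmod (\<psi> v) powr s)) powr (1 / s) * (c * (\<Sum>v\<in>L. cmod (f v) powr p)) powr (1 / p)"
    by (simp only: powr_mult powr_powr exps)
  finally show ?thesis by (simp add: level_mean_def c_def L_def s_def)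
qed

lemma hardy_norm_mult_op_le:
  assumes "0 < q" "q < p"
  shows "hardy_norm T r q (mult_op \<psi> f) \<le> hardy_norm T r (p * q / (p - q)) \<psi> * hardy_norm T r p f"
proof -
  have "ennreal (level_mean T r q n (mult_op \<psi> f))
      \<le> hardy_norm T r (p * q / (p - q)) \<psi> * hardy_norm T r p f" for n
  proof -
    have "ennreal (level_mean T r q n (mult_op \<psi> f))
        \<le> ennreal (level_mean T r (p * q / (p - q)) n \<psi>) * ennreal (level_mean T r p n f)"
      using level_mean_mult_op_le[OF assms]
      by (simp add: ennreal_leI level_mean_nonneg flip: ennreal_mult)
    also have "\<dots> \<le> hardy_norm T r (p * q / (p - q)) \<psi> * hardy_norm T r p f"
      by (intro mult_mono level_mean_le_hardy_norm) auto
    finally show ?thesis .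
  qed
  then show ?thesis
    unfolding hardy_norm_def[of T r q "mult_op \<psi> f"] by (intro SUP_least)
qed

lemma little_hardy_space_subset: "little_hardy_space T r p \<subseteq> hardy_space T r p"
  by (auto simp: little_hardy_space_def)

text \<open>Levels are disjoint, so all other level means are 0: the supremum is attained at
  \<open>n\<close>, and the sequence of means vanishes from \<open>Suc n\<close> on. This supplies
  test functions for both spaces at once.\<close>

lemma hardy_norm_eq_level_mean:
  assumes "\<And>v. v \<notin> level T r n \<Longrightarrow> f v = 0"
  shows "hardy_norm T r p f = ennreal (level_mean T r p n f)"
    and "f \<in> little_hardy_space T r p"
proof -
  have zero: "level_mean T r p m f = 0" if "m \<noteq> n" for m
  proof -
    have "f v = 0" if "v \<in> level T r m" for v
      using assms that \<open>m \<noteq> n\<close> by (auto simp: level_def)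
    then show ?thesis by (simp add: level_mean_def)
  qed
  have "ennreal (level_mean T r p m f) \<le> ennreal (level_mean T r p n f)" for m
    using zero[of m] by (cases "m = n") auto
  then show norm_eq: "hardy_norm T r p f = ennreal (level_mean T r p n f)"
    unfolding hardy_norm_def by (intro antisym SUP_least SUP_upper) auto
  have "(\<lambda>m. level_mean T r p m f) \<longlonglongrightarrow> 0"
    by (rule tendsto_eventually) (auto intro!: eventually_sequentiallyI[of "Suc n"] zero)
  then show "f \<in> little_hardy_space T r p"
    by (simp add: little_hardy_space_def hardy_space_def norm_eq)
qed

context
  fixes T :: "'a pair_pre_digraph" and r :: 'a and p q :: real and \<psi> :: "'a \<Rightarrow> complex"
  assumes finite_level: "\<And>n. finite (level T r n)"
    and exponents: "0 < q" "q < p"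
begin

text \<open>Makes the denominators of the operator quotients nonzero. Finiteness of the level
  matters, since a sum over an infinite set would be 0 by default.\<close>

lemma level_mean_pos:
  assumes "v \<in> level T r n" "f v \<noteq> 0"
  shows "0 < level_mean T r t n f"
proof -
  have "0 < (\<Sum>v\<in>level T r n. cmod (f v) powr t)"
    using assms finite_level by (intro sum_pos2[of _ v]) auto
  moreover have "card (level T r n) > 0"
    using assms finite_level by (auto simp: card_gt_0_iff)
  ultimately show ?thesis by (simp add: level_mean_def)
qed

lemma level_mean_le_op_norm:
  assumes "little_hardy_space T r p \<subseteq> X"
  shows "ennreal (level_mean T r (p * q / (p - q)) n \<psi>) \<le> op_norm T r p X q (mult_op \<psi>)"
proof (cases "\<exists>v\<in>level T r n. \<psi> v \<noteq> 0")
  \<comment> \<open>Here the extremal function would be zero and hence excluded from the supremum,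
    but the left side is 0.\<close>
  case False
  then show ?thesis by (simp add: level_mean_def)
next
  case True
  then obtain v where v: "v \<in> level T r n" "\<psi> v \<noteq> 0" by auto
  define s where "s = p * q / (p - q)"
  \<comment> \<open>The equality case of Hoelder:
    \<open>cmod (f v) powr p = cmod (\<psi> v) powr s\<close> on the level, and
    \<open>q * (1 + s / p) = s\<close> turns \<open>cmod (\<psi> v * f v) powr q\<close> into the
    same quantity.\<close>
  define f where "f v = (if v \<in> level T r n then complex_of_real (cmod (\<psi> v) powr (s / p)) else 0)" for v
  define S where "S = 1 / real (card (level T r n)) * (\<Sum>v\<in>level T r n. cmod (\<psi> v) powr s)"
  have s: "s > 0" "1 / s = 1 / q - 1 / p" "q * (1 + s / p) = s"
    using conjugate_exponent[OF exponents] exponents by (auto simp: s_def field_simps)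
  have fv: "f v \<noteq> 0" using v by (simp add: f_def)
  have v_verts: "v \<in> pverts T" using v by (simp add: level_def)
  have f_norm: "hardy_norm T r p f = ennreal (level_mean T r p n f)"
    and f_little: "f \<in> little_hardy_space T r p"
    by (auto intro!: hardy_norm_eq_level_mean simp: f_def)
  have mean_f: "level_mean T r p n f = S powr (1 / p)"
    using exponents by (simp add: level_mean_def S_def f_def powr_powr)
  have "cmod (mult_op \<psi> f v) powr q = cmod (\<psi> v) powr s" if "v \<in> level T r n" for v
  proof -
    have "cmod (mult_op \<psi> f v) = cmod (\<psi> v) powr (1 + s / p)"
      using that by (simp add: mult_op_def f_def norm_mult powr_add)
    then show ?thesis using s(3) by (simp add: powr_powr mult.commute)
  qed
  then have mean_mult: "level_mean T r q n (mult_op \<psi> f) = S powr (1 / q)"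
    by (simp add: level_mean_def S_def)
  have pos: "0 < level_mean T r p n f"
    using v(1) fv by (rule level_mean_pos)
  \<comment> \<open>Both means are powers of the one average \<open>S\<close>, so their quotient is
    \<open>S powr (1 / q - 1 / p) = S powr (1 / s)\<close>.\<close>
  have "level_mean T r s n \<psi> = level_mean T r q n (mult_op \<psi> f) / level_mean T r p n f"
    unfolding mean_f mean_mult by (simp add: level_mean_def S_def flip: powr_diff s(2))
  then have "ennreal (level_mean T r s n \<psi>)
      = ennreal (level_mean T r q n (mult_op \<psi> f)) / hardy_norm T r p f"
    using pos by (simp add: f_norm divide_ennreal level_mean_nonneg)
  also have "\<dots> \<le> hardy_norm T r q (mult_op \<psi> f) / hardy_norm T r p f"
    by (intro divide_right_mono_ennreal level_mean_le_hardy_norm)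
  also have "\<dots> \<le> op_norm T r p X q (mult_op \<psi>)"
    unfolding op_norm_def using assms f_little fv v_verts by (intro SUP_upper) auto
  finally show ?thesis by (simp add: s_def)
qed

text \<open>The set \<open>X\<close> is left open so that one proof serves the operators of (a) and
  (b). The first inclusion puts the extremal functions into \<open>X\<close>; the second makes the
  norms in the denominators finite.\<close>

lemma op_norm_mult_op:
  assumes "little_hardy_space T r p \<subseteq> X" "X \<subseteq> hardy_space T r p"
  shows "op_norm T r p X q (mult_op \<psi>) = hardy_norm T r (p * q / (p - q)) \<psi>"
proof (rule antisym)
  show "hardy_norm T r (p * q / (p - q)) \<psi> \<le> op_norm T r p X q (mult_op \<psi>)"
    unfolding hardy_norm_def by (intro SUP_least level_mean_le_op_norm assms)
next
  show "op_norm T r p X q (mult_op \<psi>) \<le> hardy_norm T r (p * q / (p - q)) \<psi>"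
    unfolding op_norm_def
  proof (intro SUP_least, clarsimp)
    fix f v assume f: "f \<in> X" and v: "v \<in> pverts T" "f v \<noteq> 0"
    \<comment> \<open>In \<open>ennreal\<close> the factor \<open>hardy_norm T r p f\<close> cancels
      once it is neither 0 nor \<infinity>. The level containing \<open>v\<close> shows that it is
      positive.\<close>
    have "0 < level_mean T r p (depth T r v) f"
      using v by (intro level_mean_pos[of v]) (auto simp: level_def)
    then have "0 < hardy_norm T r p f"
      using level_mean_le_hardy_norm[of T r p "depth T r v" f] by (meson ennreal_less_zero_iff less_le_trans)
    moreover have "hardy_norm T r p f < \<infinity>"
      using f assms by (auto simp: hardy_space_def)
    ultimately show "hardy_norm T r q (mult_op \<psi> f) / hardy_norm T r p f \<le> hardy_norm T r (p * q / (p - q)) \<psi>"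
      using divide_right_mono_ennreal[OF hardy_norm_mult_op_le[OF exponents], of T r \<psi> f "hardy_norm T r p f"]
      by (simp add: mult_divide_eq_ennreal)
  qed
qed

lemma mult_op_hardy_space:
  assumes "\<psi> \<in> hardy_space T r (p * q / (p - q))" "f \<in> hardy_space T r p"
  shows "mult_op \<psi> f \<in> hardy_space T r q"
proof -
  have "hardy_norm T r (p * q / (p - q)) \<psi> * hardy_norm T r p f < \<infinity>"
    using assms by (simp add: hardy_space_def ennreal_mult_less_top)
  with le_less_trans[OF hardy_norm_mult_op_le[OF exponents]] show ?thesis
    unfolding hardy_space_def mem_Collect_eq .
qed

text \<open>The level means of \<open>\<psi>\<close> are bounded, so those of the product are
  dominated by a constant times a null sequence.\<close>

lemma mult_op_little_hardy_space:
  assumes \<psi>: "\<psi> \<in> hardy_space T r (p * q / (p - q))" and f: "f \<in> little_hardy_space T r p"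
  shows "mult_op \<psi> f \<in> little_hardy_space T r q"
proof -
  define C where "C = enn2real (hardy_norm T r (p * q / (p - q)) \<psi>)"
  \<comment> \<open>Membership of \<open>\<psi>\<close> is what makes \<open>C\<close> a true bound:
    \<open>enn2real\<close> would send an infinite norm to 0.\<close>
  have "level_mean T r (p * q / (p - q)) n \<psi> \<le> C" for n
    using \<psi> enn2real_mono[OF level_mean_le_hardy_norm[of T r "p * q / (p - q)" n \<psi>]]
    by (simp add: C_def hardy_space_def level_mean_nonneg)
  then have bound: "level_mean T r q n (mult_op \<psi> f) \<le> C * level_mean T r p n f" for n
    by (meson level_mean_mult_op_le[OF exponents] level_mean_nonneg mult_right_mono order_trans)
  have "(\<lambda>n. C * level_mean T r p n f) \<longlonglongrightarrow> C * 0"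
    using f by (intro tendsto_mult tendsto_const) (simp add: little_hardy_space_def)
  then have "(\<lambda>n. C * level_mean T r p n f) \<longlonglongrightarrow> 0" by simp
  then have "(\<lambda>n. level_mean T r q n (mult_op \<psi> f)) \<longlonglongrightarrow> 0"
    by (rule real_tendsto_sandwich[where f = "\<lambda>_. 0", rotated 3])
      (simp_all add: bound level_mean_nonneg)
  then show ?thesis
    using mult_op_hardy_space[OF \<psi>] f by (auto simp: little_hardy_space_def)
qed

end

theorem theorem1:
  fixes T :: "'a pair_pre_digraph" and r :: 'a
    and \<psi> :: "'a \<Rightarrow> complex" and p q :: real
  assumes "infinite_rooted_tree T r"
    and "0 < q" and "q < p"
  shows
    "(bounded_op T r p (hardy_space T r p) q (hardy_space T r q) (mult_op \<psi>)
        \<longleftrightarrow> bounded_op T r p (little_hardy_space T r p) q (little_hardy_space T r q) (mult_op \<psi>)) \<and>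
     (bounded_op T r p (little_hardy_space T r p) q (little_hardy_space T r q) (mult_op \<psi>)
        \<longleftrightarrow> \<psi> \<in> hardy_space T r (p * q / (p - q))) \<and>
     (\<psi> \<in> hardy_space T r (p * q / (p - q)) \<longrightarrow>
        op_norm T r p (hardy_space T r p) q (mult_op \<psi>) = hardy_norm T r (p * q / (p - q)) \<psi> \<and>
        op_norm T r p (little_hardy_space T r p) q (mult_op \<psi>) = hardy_norm T r (p * q / (p - q)) \<psi>)"
proof -
  have fin: "finite (level T r n)" for n
    by (rule infinite_rooted_tree.finite_level[OF assms(1)])
  have norm_eq:
    "op_norm T r p (hardy_space T r p) q (mult_op \<psi>) = hardy_norm T r (p * q / (p - q)) \<psi>"
    "op_norm T r p (little_hardy_space T r p) q (mult_op \<psi>) = hardy_norm T r (p * q / (p - q)) \<psi>"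
    by (auto intro!: op_norm_mult_op fin assms little_hardy_space_subset)
  \<comment> \<open>By \<open>norm_eq\<close>, a finite operator norm is the same as (c). Conversely
    (c) also yields the mapping clause of \<open>bounded_op\<close>, through Hoelder's
    inequality.\<close>
  have "bounded_op T r p (hardy_space T r p) q (hardy_space T r q) (mult_op \<psi>)
      \<longleftrightarrow> \<psi> \<in> hardy_space T r (p * q / (p - q))"
    using mult_op_hardy_space[OF fin assms(2,3)] norm_eq(1)
    by (auto simp: bounded_op_def) (auto simp: hardy_space_def)
  moreover have "bounded_op T r p (little_hardy_space T r p) q (little_hardy_space T r q) (mult_op \<psi>)
      \<longleftrightarrow> \<psi> \<in> hardy_space T r (p * q / (p - q))"
    using mult_op_little_hardy_space[OF fin assms(2,3)] norm_eq(2)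
    by (auto simp: bounded_op_def) (auto simp: hardy_space_def)
  ultimately show ?thesis using norm_eq by simp
qed

end
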